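(* (Refined Splitting Lemma) Let $N\ge1$, let $\Omega$ be an axially symmetric slice domain in $\mathbb{H}$ and let $f$ be a slice polyanalytic function of order $N$ on $\Omega$. Then for any $I,J\in\mathbb{S}$ with $I\perp J$ there exist intrinsic functions $\psi_\ell:\Omega_I\to\mathbb{C}_I$, $\ell=0,\dots,3$, polyanalytic of order $N$, such that for all $x+yI\in\Omega_I$ $$f_I(x+yI)=\psi_0(x+yI)+\psi_1(x+yI)I+\psi_2(x+yI)J+\psi_3(x+yI)K,$$ where $K=IJ$.
   Context: $\mathbb{H}$ denotes the quaternions, $\mathbb{S}=\{q\in\mathbb{H}: q^2=-1\}$, and for $I\in\mathbb{S}$, $\mathbb{C}_I=\mathbb{R}+\mathbb{R}I$ (identified with the complex plane). For $\Omega\subset\mathbb{H}$ put $\Omega_I=\Omega\cap\mathbb{C}_I$, and $f_I$ is the restriction of $f$ to $\Omega_I$. $I\perp J$ means orthogonality in $\mathbb{H}\cong\mathbb{R}^4$. An open set $\Omega$ is axially symmetric if $x+Iy\in\Omega$ implies $x+Jy\in\Omega$ for all $J\in\mathbb{S}$. A domain (nonempty connected open set) $\Omega\subset\mathbb{H}$ is a slice domain if $\Omega\cap\mathbb{R}\neq\emptyset$ and $\Omega_I$ is a domain of $\mathbb{C}_I$ for every $I\in\mathbb{S}$. A function $\psi:\Omega_I\to\mathbb{C}_I$ is polyanalytic of order $N$ if $\left(\frac12(\partial_x+I\partial_y)\right)^N\psi=0$ on $\Omega_I$, and intrinsic if $\overline{\psi(\overline z)}=\psi(z)$ for all $z\in\Omega_I$.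 Slice polyanalytic functions: let $\Omega$ be an axially symmetric open set and $\mathcal{U}=\{(x,y)\in\mathbb{R}^2: x+Iy\in\Omega \text{ for all } I\in\mathbb{S}\}$. A function $f:\Omega\to\mathbb{H}$ is a (left) slice function if $f(x+Iy)=\alpha(x,y)+I\beta(x,y)$ for all $x+Iy\in\Omega$, $I\in\mathbb{S}$, where $\alpha,\beta:\mathcal{U}\to\mathbb{H}$ do not depend on $I$ and satisfy $\alpha(x,-y)=\alpha(x,y)$, $\beta(x,-y)=-\beta(x,y)$. If moreover $\alpha,\beta$ are of class $\mathcal{C}^N$ and $\frac{1}{2^N}(\partial_x+I\partial_y)^N(\alpha(x,y)+I\beta(x,y))=0$ for all $I\in\mathbb{S}$, then $f$ is called (left) slice polyanalytic of order $N$. *)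

theory Defs
  imports "HOL-Analysis.Analysis"
begin

section \<open>The normed division algebra of quaternions\<close>

codatatype quat = Quat (qRe: real) (qIm1: real) (qIm2: real) (qIm3: real)

lemma quat_eq_iff:
  "p = q \<longleftrightarrow> qRe p = qRe q \<and> qIm1 p = qIm1 q \<and> qIm2 p = qIm2 q \<and> qIm3 p = qIm3 q"
  by (auto intro: quat.expand)

instantiation quat :: ab_group_add
begin

primcorec zero_quat where
  "qRe 0 = 0" | "qIm1 0 = 0" | "qIm2 0 = 0" | "qIm3 0 = 0"

primcorec plus_quat where
  "qRe (p + q) = qRe p + qRe q"
| "qIm1 (p + q) = qIm1 p + qIm1 q"
| "qIm2 (p + q) = qIm2 p + qIm2 q"
| "qIm3 (p + q) = qIm3 p + qIm3 q"

primcorec uminus_quat where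
  "qRe (- p) = - qRe p"
| "qIm1 (- p) = - qIm1 p"
| "qIm2 (- p) = - qIm2 p"
| "qIm3 (- p) = - qIm3 p"

primcorec minus_quat where
  "qRe (p - q) = qRe p - qRe q"
| "qIm1 (p - q) = qIm1 p - qIm1 q"
| "qIm2 (p - q) = qIm2 p - qIm2 q"
| "qIm3 (p - q) = qIm3 p - qIm3 q"

instance
  by standard (simp_all add: quat_eq_iff)

end

instantiation quat :: real_algebra_1
begin

primcorec one_quat where
  "qRe 1 = 1" | "qIm1 1 = 0" | "qIm2 1 = 0" | "qIm3 1 = 0"

primcorec times_quat where
  "qRe (p * q) = qRe p * qRe q - qIm1 p * qIm1 q - qIm2 p * qIm2 q - qIm3 p * qIm3 q"
| "qIm1 (p * q) = qRe p * qIm1 q + qIm1 p * qRe q + qIm2 p * qIm3 q - qIm3 p * qIm2 q"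
| "qIm2 (p * q) = qRe p * qIm2 q - qIm1 p * qIm3 q + qIm2 p * qRe q + qIm3 p * qIm1 q"
| "qIm3 (p * q) = qRe p * qIm3 q + qIm1 p * qIm2 q - qIm2 p * qIm1 q + qIm3 p * qRe q"

primcorec scaleR_quat where
  "qRe (scaleR r q) = r * qRe q"
| "qIm1 (scaleR r q) = r * qIm1 q"
| "qIm2 (scaleR r q) = r * qIm2 q"
| "qIm3 (scaleR r q) = r * qIm3 q"

instance
  by standard (simp_all add: quat_eq_iff algebra_simps)

end

lemma quat_of_real [simp]:
  "qRe (of_real r) = r" "qIm1 (of_real r) = 0" "qIm2 (of_real r) = 0" "qIm3 (of_real r) = 0"
  by (simp_all add: of_real_def)

instantiation quat :: real_normed_vector
begin

definition norm_quat_def: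
  "norm q = sqrt ((qRe q)\<^sup>2 + (qIm1 q)\<^sup>2 + (qIm2 q)\<^sup>2 + (qIm3 q)\<^sup>2)"

definition sgn_quat_def: "sgn (q :: quat) = q /\<^sub>R norm q"

definition dist_quat_def: "dist p q = norm (p - q :: quat)"

definition uniformity_quat_def:
  "(uniformity :: (quat \<times> quat) filter) = (INF e\<in>{0<..}. principal {(p, q). dist p q < e})"

definition open_quat_def:
  "open (U :: quat set) \<longleftrightarrow> (\<forall>p\<in>U. eventually (\<lambda>(p', q). p' = p \<longrightarrow> q \<in> U) uniformity)"

instance
proof
  fix p q :: quat and a :: real and U :: "quat set"
  show "dist p q = norm (p - q)"
    by (simp add: dist_quat_def)
  show "sgn p = p /\<^sub>R norm p"
    by (simp add: sgn_quat_def)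
  show "uniformity = (INF e\<in>{0<..}. principal {(p :: quat, q). dist p q < e})"
    by (simp add: uniformity_quat_def)
  show "open U \<longleftrightarrow> (\<forall>p\<in>U. eventually (\<lambda>(p', q). p' = p \<longrightarrow> q \<in> U) uniformity)"
    by (simp add: open_quat_def)
  show "norm p = 0 \<longleftrightarrow> p = 0"
    by (simp add: norm_quat_def quat_eq_iff add_nonneg_eq_0_iff)
  have *: "norm r = norm ((qRe r, qIm1 r), (qIm2 r, qIm3 r))" for r
    by (simp add: norm_quat_def norm_prod_def)
  show "norm (p + q) \<le> norm p + norm q"
    using norm_triangle_ineq [of "((qRe p, qIm1 p), (qIm2 p, qIm3 p))"
                                 "((qRe q, qIm1 q), (qIm2 q, qIm3 q))"]
    by (simp add: *)
  show "norm (a *\<^sub>R p) = \<bar>a\<bar> * norm p"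
    by (simp add: norm_quat_def power_mult_distrib real_sqrt_mult flip: distrib_left)
qed

end

instantiation quat :: real_inner
begin

definition inner_quat_def:
  "inner p q = qRe p * qRe q + qIm1 p * qIm1 q + qIm2 p * qIm2 q + qIm3 p * qIm3 q"

instance
proof
  fix p :: quat
  show "inner p p = 0 \<longleftrightarrow> p = 0"
    by (simp add: inner_quat_def quat_eq_iff add_nonneg_eq_0_iff)
  show "norm p = sqrt (inner p p)"
    by (simp add: inner_quat_def norm_quat_def power2_eq_square)
qed (simp_all add: inner_quat_def algebra_simps)

end

definition quat_cnj :: "quat \<Rightarrow> quat" where
  "quat_cnj q = Quat (qRe q) (- qIm1 q) (- qIm2 q) (- qIm3 q)"

lemma quat_cnj_sel [simp]:
  "qRe (quat_cnj q) = qRe q" "qIm1 (quat_cnj q) = - qIm1 q"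
  "qIm2 (quat_cnj q) = - qIm2 q" "qIm3 (quat_cnj q) = - qIm3 q"
  by (simp_all add: quat_cnj_def)

lemma quat_mult_cnj: "q * quat_cnj q = inner q q *\<^sub>R 1"
  by (simp add: quat_eq_iff inner_quat_def algebra_simps)

lemma quat_cnj_mult: "quat_cnj q * q = inner q q *\<^sub>R 1"
  by (simp add: quat_eq_iff inner_quat_def algebra_simps)

instantiation quat :: real_normed_div_algebra
begin

definition inverse_quat_def: "inverse q = quat_cnj q /\<^sub>R inner q q"

definition divide_quat_def: "p div q = p * inverse q" for p q :: quat

instance
proof
  fix p q :: quat
  show "inverse (0 :: quat) = 0"
    by (simp add: inverse_quat_def)
  show "q \<noteq> 0 \<Longrightarrow> inverse q * q = 1"
    by (simp add: inverse_quat_def quat_cnj_mult)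
  show "q \<noteq> 0 \<Longrightarrow> q * inverse q = 1"
    by (simp add: inverse_quat_def quat_mult_cnj)
  show "p div q = p * inverse q"
    by (simp add: divide_quat_def)
  have "inner (p * q) (p * q) = inner p p * inner q q"
    by (simp add: inner_quat_def algebra_simps)
  then show "norm (p * q) = norm p * norm q"
    by (simp add: norm_eq_sqrt_inner real_sqrt_mult)
qed

end


section \<open>Slices and domains\<close>

definition imag_units :: "quat set" where
  "imag_units = {q. q\<^sup>2 = - 1}"

definition slice_plane :: "quat \<Rightarrow> quat set" where
  "slice_plane I = {of_real x + y *\<^sub>R I | x y. True}"

definition slice_of :: "quat set \<Rightarrow> quat \<Rightarrow> quat set" where
  "slice_of \<Omega> I = \<Omega> \<inter> slice_plane I"

definition axially_symmetric :: "quat set \<Rightarrow> bool" where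
  "axially_symmetric \<Omega> \<longleftrightarrow> open \<Omega> \<and>
     (\<forall>x y. \<forall>I\<in>imag_units. of_real x + y *\<^sub>R I \<in> \<Omega> \<longrightarrow>
        (\<forall>J\<in>imag_units. of_real x + y *\<^sub>R J \<in> \<Omega>))"

definition slice_domain :: "quat set \<Rightarrow> bool" where
  "slice_domain \<Omega> \<longleftrightarrow> \<Omega> \<noteq> {} \<and> open \<Omega> \<and> connected \<Omega> \<and> \<Omega> \<inter> \<real> \<noteq> {} \<and>
     (\<forall>I\<in>imag_units. slice_of \<Omega> I \<noteq> {} \<and> connected (slice_of \<Omega> I) \<and>
        openin (top_of_set (slice_plane I)) (slice_of \<Omega> I))"


section \<open>Partial derivatives and Cauchy-Riemann operators\<close>

definition partial_x :: "(real \<times> real \<Rightarrow> quat) \<Rightarrow> real \<times> real \<Rightarrow> quat" where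
  "partial_x g = (\<lambda>(x, y). vector_derivative (\<lambda>t. g (t, y)) (at x))"

definition partial_y :: "(real \<times> real \<Rightarrow> quat) \<Rightarrow> real \<times> real \<Rightarrow> quat" where
  "partial_y g = (\<lambda>(x, y). vector_derivative (\<lambda>t. g (x, t)) (at y))"

text \<open>Class \<open>C\<^sup>k\<close> on an open set \<open>U\<close>: all iterated partial derivatives
  of order at most \<open>k\<close> exist and are continuous on \<open>U\<close>.\<close>

primrec class_C :: "nat \<Rightarrow> (real \<times> real) set \<Rightarrow> (real \<times> real \<Rightarrow> quat) \<Rightarrow> bool" where
  "class_C 0 U g \<longleftrightarrow> continuous_on U g"
| "class_C (Suc k) U g \<longleftrightarrow> continuous_on U g \<and>
     (\<forall>(x, y)\<in>U. (\<lambda>t. g (t, y)) differentiable (at x) \<and>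
                   (\<lambda>t. g (x, t)) differentiable (at y)) \<and>
     class_C k U (partial_x g) \<and> class_C k U (partial_y g)"

text \<open>The operator \<open>\<partial>\<^sub>x + I \<partial>\<^sub>y\<close>.\<close>

definition CR_op :: "quat \<Rightarrow> (real \<times> real \<Rightarrow> quat) \<Rightarrow> real \<times> real \<Rightarrow> quat" where
  "CR_op I g = (\<lambda>p. partial_x g p + I * partial_y g p)"

text \<open>Functions on \<open>W \<subseteq> \<complex>\<^sub>I\<close> are differentiated in the real coordinates
  \<open>(x, y)\<close> of \<open>x + yI\<close>.  As usual, polyanalyticity of order \<open>N\<close> includes class
  \<open>C\<^sup>N\<close>, without which the iterated operator would be meaningless.\<close>

definition polyanalytic_on :: "nat \<Rightarrow> quat \<Rightarrow> quat set \<Rightarrow> (quat \<Rightarrow> quat) \<Rightarrow> bool" where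
  "polyanalytic_on N I W \<psi> \<longleftrightarrow>
     (let D = {(x, y). of_real x + y *\<^sub>R I \<in> W};
          g = (\<lambda>(x, y). \<psi> (of_real x + y *\<^sub>R I))
      in class_C N D g \<and>
         (\<forall>p\<in>D. ((\<lambda>h p. (1/2) *\<^sub>R CR_op I h p) ^^ N) g p = 0))"

definition intrinsic_on :: "quat set \<Rightarrow> (quat \<Rightarrow> quat) \<Rightarrow> bool" where
  "intrinsic_on W \<psi> \<longleftrightarrow> (\<forall>z\<in>W. quat_cnj (\<psi> (quat_cnj z)) = \<psi> z)"


section \<open>Slice polyanalytic functions\<close>

definition coord_set :: "quat set \<Rightarrow> (real \<times> real) set" where
  "coord_set \<Omega> = {(x, y). \<forall>I\<in>imag_units. of_real x + y *\<^sub>R I \<in> \<Omega>}"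

text \<open>The left slice function \<open>f\<close> on \<open>\<Omega>\<close> has components \<open>\<alpha>\<close> and \<open>\<beta>\<close>; only
  the values of \<open>f\<close> on \<open>\<Omega>\<close> and of \<open>\<alpha>\<close>, \<open>\<beta>\<close> on \<^term>\<open>coord_set \<Omega>\<close> matter.\<close>

definition slice_components ::
    "quat set \<Rightarrow> (quat \<Rightarrow> quat) \<Rightarrow> (real \<times> real \<Rightarrow> quat) \<Rightarrow> (real \<times> real \<Rightarrow> quat) \<Rightarrow> bool" where
  "slice_components \<Omega> f \<alpha> \<beta> \<longleftrightarrow>
     (\<forall>x y. \<forall>I\<in>imag_units. of_real x + y *\<^sub>R I \<in> \<Omega> \<longrightarrow>
        f (of_real x + y *\<^sub>R I) = \<alpha> (x, y) + I * \<beta> (x, y)) \<and>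
     (\<forall>(x, y)\<in>coord_set \<Omega>. \<alpha> (x, - y) = \<alpha> (x, y) \<and> \<beta> (x, - y) = - \<beta> (x, y))"

definition slice_polyanalytic :: "nat \<Rightarrow> quat set \<Rightarrow> (quat \<Rightarrow> quat) \<Rightarrow> bool" where
  "slice_polyanalytic N \<Omega> f \<longleftrightarrow>
     (\<exists>\<alpha> \<beta>. slice_components \<Omega> f \<alpha> \<beta> \<and>
        class_C N (coord_set \<Omega>) \<alpha> \<and> class_C N (coord_set \<Omega>) \<beta> \<and>
        (\<forall>I\<in>imag_units. \<forall>p\<in>coord_set \<Omega>.
           (1 / 2 ^ N) *\<^sub>R (CR_op I ^^ N) (\<lambda>p. \<alpha> p + I * \<beta> p) p = 0))"

end

theory Submission
  imports Defs
begin

text \<open>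
  In the orthonormal basis \<open>1, I, J, K\<close> of the quaternions, write the slice components as
  \<open>\<alpha> = \<alpha>\<^sub>0 + \<alpha>\<^sub>1 I + \<alpha>\<^sub>2 J + \<alpha>\<^sub>3 K\<close> and \<open>\<beta> = \<beta>\<^sub>0 + \<beta>\<^sub>1 I + \<beta>\<^sub>2 J + \<beta>\<^sub>3 K\<close> with real functions
  \<open>\<alpha>\<^sub>l\<close>, \<open>\<beta>\<^sub>l\<close>, and put \<open>\<psi>\<^sub>l(x + yI) = \<alpha>\<^sub>l(x, y) + I \<beta>\<^sub>l(x, y)\<close>. Then \<open>f = \<psi>\<^sub>0 + \<psi>\<^sub>1 I + \<psi>\<^sub>2 J + \<psi>\<^sub>3 K\<close>
  on the slice (lemma \<open>splitting_identity\<close>), and the parity of \<open>\<alpha>\<close> and \<open>\<beta>\<close> in \<open>y\<close> says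
  exactly that each \<open>\<psi>\<^sub>l\<close> is intrinsic.

  The point is that each \<open>\<psi>\<^sub>l\<close> is polyanalytic. On the slice through \<open>I\<close> alone the equation for
  \<open>f\<close> only controls \<open>\<psi>\<^sub>0 + \<psi>\<^sub>1 I\<close> and \<open>\<psi>\<^sub>2 + \<psi>\<^sub>3 I\<close>, so one has to use that it holds for several
  imaginary units. For every unit \<open>I\<close>, the \<open>n\<close>-th power of \<open>\<partial>\<^sub>x + I \<partial>\<^sub>y\<close> sends \<open>\<alpha> + I \<beta>\<close> to
  \<open>A\<^sub>n + I B\<^sub>n\<close>, where the pair \<open>(A\<^sub>n, B\<^sub>n)\<close> comes from \<open>(\<alpha>, \<beta>)\<close> by a real operator that does not
  depend on \<open>I\<close> (lemma \<open>CR_op_power_eq_CR_pair_power\<close>). Comparing the equations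
  for \<open>I\<close> and \<open>- I\<close> gives \<open>A\<^sub>N = B\<^sub>N = 0\<close>. Real operators commute with real-linear maps of the
  values (lemma \<open>CR_pair_power_bounded_linear\<close>), in particular with taking coordinates,
  so \<open>(\<alpha>\<^sub>l, \<beta>\<^sub>l)\<close> is sent to \<open>(0, 0)\<close> too, and this is the equation for \<open>\<psi>\<^sub>l\<close>.
\<close>

section \<open>Calculus of functions of class \<open>C\<^sup>k\<close>\<close>

lemma class_C_continuous_on: "class_C k U g \<Longrightarrow> continuous_on U g"
  by (cases k) auto

lemma class_C_Suc_imp_class_C: "class_C (Suc k) U g \<Longrightarrow> class_C k U g"
proof (induction k arbitrary: g)
  case (Suc k)
  then show ?case
    using class_C.simps(2)[of "Suc k" U g] class_C.simps(2)[of k U g] by blast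
qed simp

lemma class_C_Suc_has_partial_x:
  assumes "class_C (Suc k) U g" "(x, y) \<in> U"
  shows "((\<lambda>t. g (t, y)) has_vector_derivative partial_x g (x, y)) (at x)"
  using assms by (auto simp: partial_x_def vector_derivative_works[symmetric])

lemma class_C_Suc_has_partial_y:
  assumes "class_C (Suc k) U g" "(x, y) \<in> U"
  shows "((\<lambda>t. g (x, t)) has_vector_derivative partial_y g (x, y)) (at y)"
  using assms by (auto simp: partial_y_def vector_derivative_works[symmetric])

lemma partial_x_eqI:
  "((\<lambda>t. g (t, y)) has_vector_derivative d) (at x) \<Longrightarrow> partial_x g (x, y) = d"
  by (simp add: partial_x_def vector_derivative_at)

lemma partial_y_eqI:
  "((\<lambda>t. g (x, t)) has_vector_derivative d) (at y) \<Longrightarrow> partial_y g (x, y) = d"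
  by (simp add: partial_y_def vector_derivative_at)

lemma has_partial_x_cong:
  assumes "open U" "\<And>p. p \<in> U \<Longrightarrow> f p = g p" "(x, y) \<in> U"
    and "((\<lambda>t. f (t, y)) has_vector_derivative d) (at x)"
  shows "((\<lambda>t. g (t, y)) has_vector_derivative d) (at x)"
proof -
  have "open ((\<lambda>t. (t, y)) -` U)"
    using assms(1) by (intro open_vimage continuous_intros)
  then show ?thesis
    using assms by (intro has_vector_derivative_transform_within_open[OF assms(4)]) auto
qed

lemma has_partial_y_cong:
  assumes "open U" "\<And>p. p \<in> U \<Longrightarrow> f p = g p" "(x, y) \<in> U"
    and "((\<lambda>t. f (x, t)) has_vector_derivative d) (at y)"
  shows "((\<lambda>t. g (x, t)) has_vector_derivative d) (at y)"
proof -
  have "open ((\<lambda>t. (x, t)) -` U)"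
    using assms(1) by (intro open_vimage continuous_intros)
  then show ?thesis
    using assms by (intro has_vector_derivative_transform_within_open[OF assms(4)]) auto
qed

lemma class_C_cong:
  assumes "open U" "\<And>p. p \<in> U \<Longrightarrow> f p = g p" "class_C k U f"
  shows "class_C k U g"
  using assms(2,3)
proof (induction k arbitrary: f g)
  case 0
  then show ?case using continuous_on_cong by (metis class_C.simps(1))
next
  case (Suc k)
  have x: "((\<lambda>t. g (t, y)) has_vector_derivative partial_x f (x, y)) (at x)"
    if "(x, y) \<in> U" for x y
    using class_C_Suc_has_partial_x[OF Suc.prems(2) that] Suc.prems(1) that
    by (auto intro: has_partial_x_cong[OF \<open>open U\<close>, of f g])
  have y: "((\<lambda>t. g (x, t)) has_vector_derivative partial_y f (x, y)) (at y)"
    if "(x, y) \<in> U" for x y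
    using class_C_Suc_has_partial_y[OF Suc.prems(2) that] Suc.prems(1) that
    by (auto intro: has_partial_y_cong[OF \<open>open U\<close>, of f g])
  have "continuous_on U g"
    using class_C_continuous_on[OF Suc.prems(2)] Suc.prems(1) continuous_on_cong by metis
  moreover have "class_C k U (partial_x g)"
  proof (rule Suc.IH)
    show "partial_x f p = partial_x g p" if "p \<in> U" for p
      using that by (cases p) (simp add: partial_x_eqI[OF x])
    show "class_C k U (partial_x f)"
      using Suc.prems(2) by simp
  qed
  moreover have "class_C k U (partial_y g)"
  proof (rule Suc.IH)
    show "partial_y f p = partial_y g p" if "p \<in> U" for p
      using that by (cases p) (simp add: partial_y_eqI[OF y])
    show "class_C k U (partial_y f)"
      using Suc.prems(2) by simp
  qed
  ultimately show ?case
    using differentiableI_vector[OF x] differentiableI_vector[OF y] by auto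
qed

text \<open>Regularity is established by exhibiting the derivatives; on an open set it does not
  matter that \<^const>\<open>partial_x\<close> and \<^const>\<open>partial_y\<close> take arbitrary values elsewhere.\<close>

lemma class_C_SucI:
  assumes "open U" "continuous_on U g" "class_C k U gx" "class_C k U gy"
    and x: "\<And>x y. (x, y) \<in> U \<Longrightarrow> ((\<lambda>t. g (t, y)) has_vector_derivative gx (x, y)) (at x)"
    and y: "\<And>x y. (x, y) \<in> U \<Longrightarrow> ((\<lambda>t. g (x, t)) has_vector_derivative gy (x, y)) (at y)"
  shows "class_C (Suc k) U g"
proof -
  have "class_C k U (partial_x g)"
    by (rule class_C_cong[OF assms(1) _ assms(3)]) (auto simp: partial_x_eqI[OF x])
  moreover have "class_C k U (partial_y g)"
    by (rule class_C_cong[OF assms(1) _ assms(4)]) (auto simp: partial_y_eqI[OF y])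
  ultimately show ?thesis
    using differentiableI_vector[OF x] differentiableI_vector[OF y] assms(2) by auto
qed

lemma class_C_add:
  assumes "open U" "class_C k U f" "class_C k U g"
  shows "class_C k U (\<lambda>p. f p + g p)"
  using assms(2,3)
proof (induction k arbitrary: f g)
  case (Suc k)
  show ?case
  proof (rule class_C_SucI[OF assms(1)])
    show "continuous_on U (\<lambda>p. f p + g p)"
      using Suc.prems by (auto intro: continuous_intros)
    show "class_C k U (\<lambda>p. partial_x f p + partial_x g p)"
         "class_C k U (\<lambda>p. partial_y f p + partial_y g p)"
      using Suc by auto
  qed (auto intro!: has_vector_derivative_add class_C_Suc_has_partial_x
         class_C_Suc_has_partial_y Suc.prems)
qed (auto intro: continuous_intros)

lemma class_C_bounded_linear:
  assumes "open U" "bounded_linear L" "class_C k U g"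
  shows "class_C k U (\<lambda>p. L (g p))"
  using assms(3)
proof (induction k arbitrary: g)
  case 0
  then show ?case using bounded_linear.continuous_on[OF assms(2)] by auto
next
  case (Suc k)
  show ?case
  proof (rule class_C_SucI[OF assms(1)])
    show "continuous_on U (\<lambda>p. L (g p))"
      using Suc.prems bounded_linear.continuous_on[OF assms(2)] by auto
    show "class_C k U (\<lambda>p. L (partial_x g p))" "class_C k U (\<lambda>p. L (partial_y g p))"
      using Suc by auto
  qed (auto intro!: bounded_linear.has_vector_derivative[OF assms(2)]
         class_C_Suc_has_partial_x class_C_Suc_has_partial_y Suc.prems)
qed

lemma class_C_diff:
  assumes "open U" "class_C k U f" "class_C k U g"
  shows "class_C k U (\<lambda>p. f p - g p)"
  using class_C_add[OF assms(1,2) class_C_bounded_linear[OF assms(1) _ assms(3), of uminus]]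
  by (simp add: bounded_linear_minus[OF bounded_linear_ident])

section \<open>The Cauchy-Riemann operator on pairs of components\<close>

text \<open>Multiplying out \<open>(\<partial>\<^sub>x + I \<partial>\<^sub>y)(a + I b)\<close> with \<open>I\<^sup>2 = -1\<close> gives the two components below,
  in which \<open>I\<close> no longer occurs.\<close>

definition CR_pair ::
    "(real \<times> real \<Rightarrow> quat) \<times> (real \<times> real \<Rightarrow> quat) \<Rightarrow>
     (real \<times> real \<Rightarrow> quat) \<times> (real \<times> real \<Rightarrow> quat)" where
  "CR_pair = (\<lambda>(a, b). (\<lambda>p. partial_x a p - partial_y b p, \<lambda>p. partial_x b p + partial_y a p))"

lemma CR_pair_Pair:
  "CR_pair (a, b) = (\<lambda>p. partial_x a p - partial_y b p, \<lambda>p. partial_x b p + partial_y a p)"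
  by (simp add: CR_pair_def)

lemma class_C_CR_pair_power:
  assumes "open U" "class_C (n + k) U a" "class_C (n + k) U b"
  shows "class_C k U (fst ((CR_pair ^^ n) (a, b))) \<and> class_C k U (snd ((CR_pair ^^ n) (a, b)))"
  using assms(2,3)
proof (induction n arbitrary: k)
  case (Suc n)
  obtain A B where AB: "(CR_pair ^^ n) (a, b) = (A, B)"
    by fastforce
  have "class_C (Suc k) U A" "class_C (Suc k) U B"
    using Suc.IH[of "Suc k"] Suc.prems AB by (simp_all del: class_C.simps)
  then show ?case
    using assms(1) by (auto simp: AB CR_pair_Pair intro!: class_C_add class_C_diff)
qed auto

lemma CR_pair_power_bounded_linear:
  assumes "open U" "bounded_linear L" "class_C n U a" "class_C n U b" "p \<in> U"
  shows "fst ((CR_pair ^^ n) (\<lambda>p. L (a p), \<lambda>p. L (b p))) p = L (fst ((CR_pair ^^ n) (a, b)) p) \<and>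
         snd ((CR_pair ^^ n) (\<lambda>p. L (a p), \<lambda>p. L (b p))) p = L (snd ((CR_pair ^^ n) (a, b)) p)"
  using assms(3-5)
proof (induction n arbitrary: p)
  case (Suc n)
  obtain A B where AB: "(CR_pair ^^ n) (a, b) = (A, B)"
    by fastforce
  obtain A' B' where AB': "(CR_pair ^^ n) (\<lambda>p. L (a p), \<lambda>p. L (b p)) = (A', B')"
    by fastforce
  obtain x y where p: "p = (x, y)"
    by fastforce
  have eq: "L (A q) = A' q" "L (B q) = B' q" if "q \<in> U" for q
    using Suc.IH[OF class_C_Suc_imp_class_C[OF Suc.prems(1)] class_C_Suc_imp_class_C[OF Suc.prems(2)] that]
    by (simp_all add: AB AB')
  have C: "class_C (Suc 0) U A" "class_C (Suc 0) U B"
    using class_C_CR_pair_power[OF assms(1), of n "Suc 0" a b] Suc.prems(1,2) AB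
    by (simp_all del: class_C.simps)
  have U: "(x, y) \<in> U"
    using Suc.prems p by simp
  note lin = bounded_linear.has_vector_derivative[OF assms(2)]
  have "partial_x A' p = L (partial_x A p)"
    unfolding p by (rule partial_x_eqI, rule has_partial_x_cong[OF assms(1) eq(1) U])
      (assumption, rule lin[OF class_C_Suc_has_partial_x[OF C(1) U]])
  moreover have "partial_x B' p = L (partial_x B p)"
    unfolding p by (rule partial_x_eqI, rule has_partial_x_cong[OF assms(1) eq(2) U])
      (assumption, rule lin[OF class_C_Suc_has_partial_x[OF C(2) U]])
  moreover have "partial_y A' p = L (partial_y A p)"
    unfolding p by (rule partial_y_eqI, rule has_partial_y_cong[OF assms(1) eq(1) U])
      (assumption, rule lin[OF class_C_Suc_has_partial_y[OF C(1) U]])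
  moreover have "partial_y B' p = L (partial_y B p)"
    unfolding p by (rule partial_y_eqI, rule has_partial_y_cong[OF assms(1) eq(2) U])
      (assumption, rule lin[OF class_C_Suc_has_partial_y[OF C(2) U]])
  ultimately show ?case
    using assms(2) by (simp add: AB AB' CR_pair_Pair linear_simps)
qed auto

lemma imag_unit_mult_self: "I \<in> imag_units \<Longrightarrow> I * I = - 1"
  by (simp add: imag_units_def power2_eq_square)

text \<open>The factor \<open>c\<close> covers both normalisations of the Cauchy-Riemann operator. It is
  carried through the induction because \<^const>\<open>vector_derivative\<close> takes a fixed arbitrary value
  where no derivative exists, so that \<^const>\<open>CR_op\<close> is homogeneous only at points of
  differentiability.\<close>

lemma CR_op_power_eq_CR_pair_power:
  assumes "open U" "I \<in> imag_units" "class_C n U a" "class_C n U b" "p \<in> U"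
  shows "((\<lambda>h p. c *\<^sub>R CR_op I h p) ^^ n) (\<lambda>p. a p + I * b p) p =
    c ^ n *\<^sub>R (fst ((CR_pair ^^ n) (a, b)) p + I * snd ((CR_pair ^^ n) (a, b)) p)"
  using assms(3-5)
proof (induction n arbitrary: p)
  case (Suc n)
  obtain A B where AB: "(CR_pair ^^ n) (a, b) = (A, B)"
    by fastforce
  define F where "F = ((\<lambda>h p. c *\<^sub>R CR_op I h p) ^^ n) (\<lambda>p. a p + I * b p)"
  obtain x y where p: "p = (x, y)"
    by fastforce
  have eq: "c ^ n *\<^sub>R (A q + I * B q) = F q" if "q \<in> U" for q
    using Suc.IH[OF class_C_Suc_imp_class_C[OF Suc.prems(1)] class_C_Suc_imp_class_C[OF Suc.prems(2)] that]
    by (simp add: AB F_def)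
  have C: "class_C (Suc 0) U A" "class_C (Suc 0) U B"
    using class_C_CR_pair_power[OF assms(1), of n "Suc 0" a b] Suc.prems(1,2) AB
    by (simp_all del: class_C.simps)
  have U: "(x, y) \<in> U"
    using Suc.prems p by simp
  have lin: "bounded_linear (\<lambda>q. c ^ n *\<^sub>R q)" "bounded_linear (\<lambda>q. I * q)"
    by (rule bounded_linear_scaleR_right bounded_linear_mult_right)+
  note deriv = bounded_linear.has_vector_derivative[OF lin(1)] has_vector_derivative_add
    bounded_linear.has_vector_derivative[OF lin(2)]
  have "((\<lambda>t. c ^ n *\<^sub>R (A (t, y) + I * B (t, y))) has_vector_derivative
      c ^ n *\<^sub>R (partial_x A (x, y) + I * partial_x B (x, y))) (at x)"
    using C U by (intro deriv class_C_Suc_has_partial_x)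
  then have dx: "partial_x F p = c ^ n *\<^sub>R (partial_x A p + I * partial_x B p)"
    unfolding p by (intro partial_x_eqI) (rule has_partial_x_cong[OF assms(1) eq U])
  have "((\<lambda>t. c ^ n *\<^sub>R (A (x, t) + I * B (x, t))) has_vector_derivative
      c ^ n *\<^sub>R (partial_y A (x, y) + I * partial_y B (x, y))) (at y)"
    using C U by (intro deriv class_C_Suc_has_partial_y)
  then have dy: "partial_y F p = c ^ n *\<^sub>R (partial_y A p + I * partial_y B p)"
    unfolding p by (intro partial_y_eqI) (rule has_partial_y_cong[OF assms(1) eq U])
  have II: "I * (I * q) = - q" for q
    using imag_unit_mult_self[OF assms(2)] by (simp flip: mult.assoc)
  have "((\<lambda>h p. c *\<^sub>R CR_op I h p) ^^ Suc n) (\<lambda>p. a p + I * b p) p = c *\<^sub>R CR_op I F p"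
    by (simp add: F_def)
  also have "\<dots> = c ^ Suc n *\<^sub>R (fst (CR_pair (A, B)) p + I * snd (CR_pair (A, B)) p)"
    by (simp add: CR_op_def dx dy CR_pair_Pair II algebra_simps)
  finally show ?case
    by (simp add: AB)
qed auto

section \<open>Imaginary units and coordinates on a slice\<close>

lemma imag_unit_qRe_norm:
  assumes "I \<in> imag_units"
  shows "qRe I = 0" "qIm1 I * qIm1 I + qIm2 I * qIm2 I + qIm3 I * qIm3 I = 1"
proof -
  have eqs: "qRe I * qRe I - qIm1 I * qIm1 I - qIm2 I * qIm2 I - qIm3 I * qIm3 I = - 1"
    "qRe I * qIm1 I = 0" "qRe I * qIm2 I = 0" "qRe I * qIm3 I = 0"
    using imag_unit_mult_self[OF assms] by (auto simp: quat_eq_iff)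
  show "qRe I = 0"
  proof (rule ccontr)
    assume "qRe I \<noteq> 0"
    \<comment> \<open>then \<open>I\<close> would be real, with a negative square\<close>
    with eqs have "qRe I * qRe I = - 1"
      by auto
    then show False
      using zero_le_square[of "qRe I"] by linarith
  qed
  with eqs(1) show "qIm1 I * qIm1 I + qIm2 I * qIm2 I + qIm3 I * qIm3 I = 1"
    by simp
qed

lemma minus_imag_unit: "I \<in> imag_units \<Longrightarrow> - I \<in> imag_units"
  by (simp add: imag_units_def)

text \<open>The scalar product with a vector of the basis \<open>1, I, J, IJ\<close> gives the coordinate there. The
  proof is in components: \<open>IJ\<close> is the cross product of the orthonormal vectors \<open>I\<close> and \<open>J\<close>, and
  a matrix with orthonormal rows has orthonormal columns.\<close>

lemma quat_orthonormal_expansion: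
  assumes "I \<in> imag_units" "J \<in> imag_units" "orthogonal I J"
  shows "q = of_real (inner q 1) + of_real (inner q I) * I + of_real (inner q J) * J +
    of_real (inner q (I * J)) * (I * J)"
proof -
  obtain a b c where I: "I = Quat 0 a b c"
    using imag_unit_qRe_norm(1)[OF assms(1)] by (metis quat.collapse)
  obtain d e f where J: "J = Quat 0 d e f"
    using imag_unit_qRe_norm(1)[OF assms(2)] by (metis quat.collapse)
  have n: "a * a + b * b + c * c = 1" "d * d + e * e + f * f = 1" "a * d + b * e + c * f = 0"
    using imag_unit_qRe_norm(2)[OF assms(1)] imag_unit_qRe_norm(2)[OF assms(2)] assms(3)
    by (auto simp: I J orthogonal_def inner_quat_def)
  have "x = (x * a + y * b + z * c) * a + (x * d + y * e + z * f) * d +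
      (x * (b * f - c * e) + y * (c * d - a * f) + z * (a * e - b * d)) * (b * f - c * e)"
    "y = (x * a + y * b + z * c) * b + (x * d + y * e + z * f) * e +
      (x * (b * f - c * e) + y * (c * d - a * f) + z * (a * e - b * d)) * (c * d - a * f)"
    "z = (x * a + y * b + z * c) * c + (x * d + y * e + z * f) * f +
      (x * (b * f - c * e) + y * (c * d - a * f) + z * (a * e - b * d)) * (a * e - b * d)"
    for x y z
    using n by algebra+
  note coordinates = this[where x = "qIm1 q" and y = "qIm2 q" and z = "qIm3 q"]
  have "I * J = Quat 0 (b * f - c * e) (c * d - a * f) (a * e - b * d)"
    using n(3) by (simp add: I J quat_eq_iff)
  then show ?thesis
    using coordinates by (simp add: quat_eq_iff inner_quat_def I J)
qed

lemma open_slice_coordinates: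
  assumes "open \<Omega>"
  shows "open {(x, y). of_real x + y *\<^sub>R (I :: quat) \<in> \<Omega>}"
proof -
  have "{(x, y). of_real x + y *\<^sub>R I \<in> \<Omega>} = (\<lambda>p. of_real (fst p) + snd p *\<^sub>R I) -` \<Omega>"
    by auto
  then show ?thesis
    using assms by (auto intro!: open_vimage continuous_intros)
qed

lemma coord_set_axially_symmetric:
  assumes "axially_symmetric \<Omega>" "I \<in> imag_units"
  shows "coord_set \<Omega> = {(x, y). of_real x + y *\<^sub>R I \<in> \<Omega>}"
  using assms unfolding coord_set_def axially_symmetric_def by blast

lemma slice_of_coordinates:
  assumes "I \<in> imag_units"
  shows "qRe (of_real x + y *\<^sub>R I) = x" "inner (of_real x + y *\<^sub>R I) I = y"
    "quat_cnj (of_real x + y *\<^sub>R I) = of_real x + (- y) *\<^sub>R I"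
  using imag_unit_qRe_norm[OF assms]
  by (simp_all add: inner_quat_def quat_eq_iff mult.assoc flip: distrib_left)

text \<open>Since \<open>\<beta>\<close> stands to the right of \<open>I\<close> in \<open>\<alpha> + I \<beta>\<close> and the coordinates are taken with the basis
  vectors on the right, the factor \<open>I\<close> never has to pass a basis vector, with which it
  need not commute.\<close>

lemma splitting_identity:
  assumes "I \<in> imag_units" "J \<in> imag_units" "orthogonal I J"
  defines "R \<equiv> \<lambda>e q. of_real (inner q e) :: quat"
  shows "a + I * b = (R 1 a + I * R 1 b) + (R I a + I * R I b) * I + (R J a + I * R J b) * J +
    (R (I * J) a + I * R (I * J) b) * (I * J)"
proof -
  have "a = R 1 a + R I a * I + R J a * J + R (I * J) a * (I * J)"
    "b = R 1 b + R I b * I + R J b * J + R (I * J) b * (I * J)"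
    unfolding R_def by (rule quat_orthonormal_expansion[OF assms(1-3)])+
  then have "a + I * b = (R 1 a + R I a * I + R J a * J + R (I * J) a * (I * J)) +
      I * (R 1 b + R I b * I + R J b * J + R (I * J) b * (I * J))"
    by simp
  then show ?thesis
    by (simp add: algebra_simps)
qed

section \<open>The splitting lemma\<close>

text \<open>Here the equations for \<open>I\<close> and \<open>- I\<close> are combined.\<close>

lemma slice_polyanalytic_CR_pair_power_eq_0:
  assumes "open U" "I \<in> imag_units" "class_C N U \<alpha>" "class_C N U \<beta>" "p \<in> U"
    and "\<And>I. I \<in> imag_units \<Longrightarrow> (1 / 2 ^ N) *\<^sub>R (CR_op I ^^ N) (\<lambda>p. \<alpha> p + I * \<beta> p) p = 0"
  shows "fst ((CR_pair ^^ N) (\<alpha>, \<beta>)) p = 0 \<and> snd ((CR_pair ^^ N) (\<alpha>, \<beta>)) p = 0"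
proof -
  have zero: "fst ((CR_pair ^^ N) (\<alpha>, \<beta>)) p + H * snd ((CR_pair ^^ N) (\<alpha>, \<beta>)) p = 0"
    if "H \<in> imag_units" for H
    using assms(6)[OF that] CR_op_power_eq_CR_pair_power[OF assms(1) that assms(3-5), of 1]
    by simp
  have "A = 0 \<and> B = 0" if "A + I * B = 0" "A + (- I) * B = 0" for A B
  proof -
    have "2 *\<^sub>R A = (A + I * B) + (A + (- I) * B)"
      by (simp add: scaleR_2)
    with that have "A = 0"
      by simp
    moreover have "I \<noteq> 0"
      using imag_unit_mult_self[OF assms(2)] by auto
    ultimately show ?thesis
      using that by simp
  qed
  then show ?thesis
    using zero[OF assms(2)] zero[OF minus_imag_unit[OF assms(2)]] by blast
qed

theorem proposition3p14:
  fixes N :: nat and \<Omega> :: "quat set" and f :: "quat \<Rightarrow> quat" and I J :: quat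
  assumes "N \<ge> 1"
    and "axially_symmetric \<Omega>" and "slice_domain \<Omega>"
    and "slice_polyanalytic N \<Omega> f"
    and "I \<in> imag_units" and "J \<in> imag_units" and "orthogonal I J"
  shows "\<exists>\<psi> :: nat \<Rightarrow> quat \<Rightarrow> quat.
    (\<forall>l\<in>{0..3}. \<psi> l ` slice_of \<Omega> I \<subseteq> slice_plane I \<and>
        intrinsic_on (slice_of \<Omega> I) (\<psi> l) \<and>
        polyanalytic_on N I (slice_of \<Omega> I) (\<psi> l)) \<and>
    (\<forall>x y. of_real x + y *\<^sub>R I \<in> slice_of \<Omega> I \<longrightarrow>
        (let z = of_real x + y *\<^sub>R I; K = I * J
         in f z = \<psi> 0 z + \<psi> 1 z * I + \<psi> 2 z * J + \<psi> 3 z * K))"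
proof -
  define U where "U = coord_set \<Omega>"
  note U_eq = coord_set_axially_symmetric[OF assms(2,5), folded U_def]
  have "open \<Omega>"
    using assms(2) by (simp add: axially_symmetric_def)
  then have "open U"
    unfolding U_eq by (rule open_slice_coordinates)
  have in_slice: "of_real x + y *\<^sub>R I \<in> slice_of \<Omega> I \<longleftrightarrow> (x, y) \<in> U" for x y
    by (auto simp: U_eq slice_of_def slice_plane_def)
  obtain \<alpha> \<beta> where comp: "slice_components \<Omega> f \<alpha> \<beta>"
    and C: "class_C N U \<alpha>" "class_C N U \<beta>"
    and CR: "\<And>I p. I \<in> imag_units \<Longrightarrow> p \<in> U \<Longrightarrow>
      (1 / 2 ^ N) *\<^sub>R (CR_op I ^^ N) (\<lambda>p. \<alpha> p + I * \<beta> p) p = 0"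
    using assms(4) unfolding slice_polyanalytic_def U_def by blast
  have f_eq: "f (of_real x + y *\<^sub>R I) = \<alpha> (x, y) + I * \<beta> (x, y)" if "(x, y) \<in> U" for x y
    using comp that assms(5) unfolding slice_components_def U_eq by blast
  have parity: "\<alpha> (x, - y) = \<alpha> (x, y)" "\<beta> (x, - y) = - \<beta> (x, y)" if "(x, y) \<in> U" for x y
    using comp that unfolding slice_components_def U_def by blast+

  \<comment> \<open>the intrinsic function that belongs to the coordinate in direction \<open>e\<close>\<close>
  define \<Psi> where "\<Psi> e z = of_real (inner (\<alpha> (qRe z, inner z I)) e) +
    I * of_real (inner (\<beta> (qRe z, inner z I)) e)" for e z
  have \<Psi>: "\<Psi> e (of_real x + y *\<^sub>R I) =
      of_real (inner (\<alpha> (x, y)) e) + I * of_real (inner (\<beta> (x, y)) e)" for e x y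
    unfolding \<Psi>_def slice_of_coordinates[OF assms(5)] ..
  have plane: "\<Psi> e z \<in> slice_plane I" for e z
    by (auto simp: \<Psi>_def slice_plane_def of_real_def)
  have intrinsic: "intrinsic_on (slice_of \<Omega> I) (\<Psi> e)" for e
    unfolding intrinsic_on_def
  proof
    fix z assume z: "z \<in> slice_of \<Omega> I"
    then obtain x y where z_eq: "z = of_real x + y *\<^sub>R I"
      by (auto simp: slice_of_def slice_plane_def)
    with z have "(x, y) \<in> U"
      by (simp add: in_slice)
    with imag_unit_qRe_norm(1)[OF assms(5)] show "quat_cnj (\<Psi> e (quat_cnj z)) = \<Psi> e z"
      unfolding z_eq slice_of_coordinates(3)[OF assms(5)] \<Psi>
      by (simp add: parity quat_eq_iff)
  qed
  have poly: "polyanalytic_on N I (slice_of \<Omega> I) (\<Psi> e)" for e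
  proof -
    define R where "R q = (of_real (inner q e) :: quat)" for q
    have R: "bounded_linear R"
      unfolding R_def
      by (rule bounded_linear_compose[OF bounded_linear_of_real bounded_linear_inner_left])
    have CR': "class_C N U (\<lambda>p. R (\<alpha> p))" "class_C N U (\<lambda>p. R (\<beta> p))"
      by (rule class_C_bounded_linear[OF \<open>open U\<close> R] C)+
    have C\<psi>: "class_C N U (\<lambda>p. R (\<alpha> p) + I * R (\<beta> p))"
      using \<open>open U\<close> CR'
      by (intro class_C_add class_C_bounded_linear[OF _ bounded_linear_mult_right])
    have "((\<lambda>h p. (1/2) *\<^sub>R CR_op I h p) ^^ N) (\<lambda>p. R (\<alpha> p) + I * R (\<beta> p)) p = 0"
      if "p \<in> U" for p
      unfolding CR_op_power_eq_CR_pair_power[OF \<open>open U\<close> assms(5) CR' that]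
      using CR_pair_power_bounded_linear[OF \<open>open U\<close> R C that] linear_0[OF bounded_linear.linear[OF R]]
        slice_polyanalytic_CR_pair_power_eq_0[OF \<open>open U\<close> assms(5) C that CR[OF _ that]]
      by simp
    moreover have "{(x, y). of_real x + y *\<^sub>R I \<in> slice_of \<Omega> I} = U"
      by (auto simp: in_slice)
    moreover have "(\<lambda>(x, y). \<Psi> e (of_real x + y *\<^sub>R I)) = (\<lambda>p. R (\<alpha> p) + I * R (\<beta> p))"
      by (auto simp: \<Psi> R_def)
    ultimately show ?thesis
      using C\<psi> unfolding polyanalytic_on_def by (simp add: Let_def)
  qed
  have split: "f z = \<Psi> 1 z + \<Psi> I z * I + \<Psi> J z * J + \<Psi> (I * J) z * (I * J)"
    if "z = of_real x + y *\<^sub>R I" "z \<in> slice_of \<Omega> I" for x y z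
    using that splitting_identity[OF assms(5-7), of "\<alpha> (x, y)" "\<beta> (x, y)"]
    by (simp only: in_slice f_eq \<Psi>)
  define e where "e l = [1, I, J, I * J] ! l" for l
  have e: "e 0 = 1" "e 1 = I" "e 2 = J" "e 3 = I * J"
    by (simp_all add: e_def)
  show ?thesis
    using plane intrinsic poly split
    by (intro exI[of _ "\<lambda>l. \<Psi> (e l)"]) (auto simp: Let_def e simp del: One_nat_def)
qed

end
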